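(* Let $P$, $X$, $Y$ be metric spaces, $P\times X$ being equipped with the max distance, let $C\subset Y$ be a nonempty closed proper subset, let $F:P\times X\rightrightarrows Y$ be a set-valued mapping with $F(p,x)\neq\varnothing$ for all $(p,x)\in P\times X$, and let $\vartheta:P\times X\to\mathbb R$ be a function. For $p\in P$ let $S(p)=\{x\in X: F(p,x)\subseteq C\}$, $\mathrm{val}(p)=\inf_{x\in S(p)}\vartheta(p,x)$ and $\mathrm{Argmin}(p)=\{x\in S(p):\vartheta(p,x)\le\mathrm{val}(p)\}$, and let $\varphi_F(p,x)=\sup_{y\in F(p,x)}\mathrm{dist}(y,C)$. Let $\bar p\in P$ and $\bar x\in\mathrm{Argmin}(\bar p)$. Suppose that: (i) $(X,d)$ is metrically complete; (ii) the set-valued mapping $F(\bar p,\cdot):X\rightrightarrows Y$ is lower semicontinuous on $X$; (iii) the mapping $F$ is locally Lipschitz near $\bar p$ with respect to $p$, uniformly in $x\in X$; (iv) $\tau_{\bar p}>0$; (v) $\vartheta$ is Lipschitz continuous on $P\times X$. Then $\mathrm{val}:P\to\mathbb R\cup\{\pm\infty\}$ is calm from below at $\bar p$ and $$\underline{\mathrm{clm}}\,\mathrm{val}(\bar p)\le\mathrm{Lip}\,\vartheta(P,X)\cdot\max\left\{1,\ \frac{\mathrm{Lip_p}\,F(\bar p,X)}{\tau_{\bar p}}\right\}.$$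
   Context: All metrics are denoted $d$. $B(x,r)$ is the closed ball of center $x$ and radius $r$; $\mathrm{dist}(x,A)=\inf_{a\in A}d(x,a)$. For subsets $A,B$ of a metric space, $\mathrm{exc}(A,B)=\sup_{a\in A}\mathrm{dist}(a,B)$ and $\mathrm{haus}(A,B)=\max\{\mathrm{exc}(A,B),\mathrm{exc}(B,A)\}$. A set-valued mapping $\Phi:X\rightrightarrows Y$ between metric spaces is lower semicontinuous (l.s.c.) at $\bar x$ if for every open $O\subseteq Y$ with $\Phi(\bar x)\cap O\neq\varnothing$ there is a neighbourhood $U$ of $\bar x$ with $\Phi(x)\cap O\ne\varnothing$ for all $x\in U$. $F$ is locally Lipschitz near $\bar p$ with respect to $p$, uniformly in $x\in X$, if there are $\ell,\delta>0$ such that $\sup_{x\in X}\mathrm{haus}(F(p_1,x),F(p_2,x))\le\ell d(p_1,p_2)$ for all $p_1,p_2\in B(\bar p,\delta)$; $\mathrm{Lip_p}\,F(\bar p,X)$ is the infimum of all $\ell>0$ for which such a $\delta>0$ exists. $\mathrm{Lip}\,\vartheta(P,X)$ is the infimum of all $\ell>0$ such that $|\vartheta(p_1,x_1)-\vartheta(p_2,x_2)|\le\ell\max\{d(p_1,p_2),d(x_1,x_2)\}$ for all $(p_1,x_1),(p_2,x_2)\in P\times X$. A function $g:P\to\mathbb R\cup\{\pm\infty\}$ is calm from below at a point $\bar p$ with $g(\bar p)\in\mathbb R$ if there are $\delta,\ell>0$ such that $g(p)-g(\bar p)\ge-\ell d(p,\bar p)$ for all $p\in B(\bar p,\delta)$;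 $\underline{\mathrm{clm}}\,g(\bar p)$ is the infimum of all $\ell>0$ for which such a $\delta>0$ exists. By convention $\mathrm{val}(p)=+\infty$ if $S(p)=\varnothing$. The strong slope of $\psi:X\to\mathbb R\cup\{\pm\infty\}$ at a point $x$ with $\psi(x)\in\mathbb R$ is $|\nabla\psi|(x)=0$ if $x$ is a local minimizer of $\psi$, and $|\nabla\psi|(x)=\limsup_{z\to x}\frac{\psi(x)-\psi(z)}{d(z,x)}$ otherwise. Set $$\tau_{\bar p}=\inf\{|\nabla\varphi_F(\bar p,\cdot)|(x): x\in X\setminus S(\bar p)\},$$ the infimum being over those $x$ at which the slope is defined, i.e. $\varphi_F(\bar p,x)<+\infty$, with $\inf\varnothing=+\infty$; a finite number divided by $+\infty$ is $0$. *)

theory Defs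
  imports "HOL-Analysis.Analysis"
begin

text \<open>
  Mappings on a product \<open>P \<times> X\<close> are curried, since the library metric on pairs is the Euclidean one;
  the max distance is written out in the Lipschitz condition for \<open>\<theta>\<close>, the only place where the
  product metric is used.  Suprema, infima and moduli live in \<^typ>\<open>ereal\<close>, so that the infimum of the
  empty set is \<open>\<infinity>\<close> and a finite number divided by \<open>\<infinity>\<close> is \<open>0\<close>.
\<close>

subsection \<open>Set-valued mappings\<close>

text \<open>
  \<^const>\<open>infdist\<close> agrees with the distance to a set for nonempty sets only (it is \<open>0\<close> for the empty
  set); below it is only applied to values of \<open>F\<close> and to \<open>C\<close>, which are assumed nonempty.
\<close>

definition exc :: "'a::metric_space set \<Rightarrow> 'a set \<Rightarrow> ereal" where
  "exc A B = (SUP a\<in>A. ereal (infdist a B))"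

definition haus :: "'a::metric_space set \<Rightarrow> 'a set \<Rightarrow> ereal" where
  "haus A B = max (exc A B) (exc B A)"

definition lsc_at :: "('x::metric_space \<Rightarrow> 'y::metric_space set) \<Rightarrow> 'x \<Rightarrow> bool" where
  "lsc_at \<Phi> x \<longleftrightarrow>
    (\<forall>U. open U \<longrightarrow> \<Phi> x \<inter> U \<noteq> {} \<longrightarrow> (\<forall>\<^sub>F z in nhds x. \<Phi> z \<inter> U \<noteq> {}))"

definition unif_loc_lipschitz_const ::
    "('p::metric_space \<Rightarrow> 'x::metric_space \<Rightarrow> 'y::metric_space set) \<Rightarrow> 'p \<Rightarrow> real \<Rightarrow> bool" where
  "unif_loc_lipschitz_const F p l \<longleftrightarrow>
    (\<exists>\<delta>>0. \<forall>p1\<in>cball p \<delta>. \<forall>p2\<in>cball p \<delta>.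
       (SUP x. haus (F p1 x) (F p2 x)) \<le> ereal (l * dist p1 p2))"

definition unif_loc_lipschitz ::
    "('p::metric_space \<Rightarrow> 'x::metric_space \<Rightarrow> 'y::metric_space set) \<Rightarrow> 'p \<Rightarrow> bool" where
  "unif_loc_lipschitz F p \<longleftrightarrow> (\<exists>l>0. unif_loc_lipschitz_const F p l)"

definition Lip_p ::
    "('p::metric_space \<Rightarrow> 'x::metric_space \<Rightarrow> 'y::metric_space set) \<Rightarrow> 'p \<Rightarrow> ereal" where
  "Lip_p F p = Inf (ereal ` {l. 0 < l \<and> unif_loc_lipschitz_const F p l})"

subsection \<open>Real- and extended-real-valued functions\<close>

definition max_lipschitz_const ::
    "('p::metric_space \<Rightarrow> 'x::metric_space \<Rightarrow> real) \<Rightarrow> real \<Rightarrow> bool" where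
  "max_lipschitz_const \<theta> l \<longleftrightarrow>
    (\<forall>p1 x1 p2 x2. \<bar>\<theta> p1 x1 - \<theta> p2 x2\<bar> \<le> l * max (dist p1 p2) (dist x1 x2))"

definition max_lipschitz :: "('p::metric_space \<Rightarrow> 'x::metric_space \<Rightarrow> real) \<Rightarrow> bool" where
  "max_lipschitz \<theta> \<longleftrightarrow> (\<exists>l>0. max_lipschitz_const \<theta> l)"

definition Lip :: "('p::metric_space \<Rightarrow> 'x::metric_space \<Rightarrow> real) \<Rightarrow> ereal" where
  "Lip \<theta> = Inf (ereal ` {l. 0 < l \<and> max_lipschitz_const \<theta> l})"

definition calm_below_const :: "('p::metric_space \<Rightarrow> ereal) \<Rightarrow> 'p \<Rightarrow> real \<Rightarrow> bool" where
  "calm_below_const g p l \<longleftrightarrow>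
    (\<exists>\<delta>>0. \<forall>q\<in>cball p \<delta>. g q - g p \<ge> ereal (- l * dist q p))"

definition calm_from_below :: "('p::metric_space \<Rightarrow> ereal) \<Rightarrow> 'p \<Rightarrow> bool" where
  "calm_from_below g p \<longleftrightarrow> \<bar>g p\<bar> \<noteq> \<infinity> \<and> (\<exists>l>0. calm_below_const g p l)"

definition clm_below :: "('p::metric_space \<Rightarrow> ereal) \<Rightarrow> 'p \<Rightarrow> ereal" where
  "clm_below g p = Inf (ereal ` {l. 0 < l \<and> calm_below_const g p l})"

text \<open>Meaningful only at points where \<open>\<psi>\<close> is finite.\<close>

definition strong_slope :: "('x::metric_space \<Rightarrow> ereal) \<Rightarrow> 'x \<Rightarrow> ereal" where
  "strong_slope \<psi> x =
    (if \<forall>\<^sub>F z in nhds x. \<psi> x \<le> \<psi> z then 0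
     else Limsup (at x) (\<lambda>z. (\<psi> x - \<psi> z) / ereal (dist z x)))"

subsection \<open>The parametric optimization problem\<close>

definition feasible :: "('p \<Rightarrow> 'x \<Rightarrow> 'y set) \<Rightarrow> 'y set \<Rightarrow> 'p \<Rightarrow> 'x set" where
  "feasible F C p = {x. F p x \<subseteq> C}"

definition opt_val :: "('p \<Rightarrow> 'x \<Rightarrow> 'y set) \<Rightarrow> 'y set \<Rightarrow> ('p \<Rightarrow> 'x \<Rightarrow> real) \<Rightarrow> 'p \<Rightarrow> ereal" where
  "opt_val F C \<theta> p = (INF x\<in>feasible F C p. ereal (\<theta> p x))"

definition Argmin :: "('p \<Rightarrow> 'x \<Rightarrow> 'y set) \<Rightarrow> 'y set \<Rightarrow> ('p \<Rightarrow> 'x \<Rightarrow> real) \<Rightarrow> 'p \<Rightarrow> 'x set" where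
  "Argmin F C \<theta> p = {x \<in> feasible F C p. ereal (\<theta> p x) \<le> opt_val F C \<theta> p}"

definition phi :: "('p \<Rightarrow> 'x \<Rightarrow> 'y::metric_space set) \<Rightarrow> 'y set \<Rightarrow> 'p \<Rightarrow> 'x \<Rightarrow> ereal" where
  "phi F C p x = (SUP y\<in>F p x. ereal (infdist y C))"

definition tau :: "('p \<Rightarrow> 'x::metric_space \<Rightarrow> 'y::metric_space set) \<Rightarrow> 'y set \<Rightarrow> 'p \<Rightarrow> ereal" where
  "tau F C p = (INF x\<in>{x. x \<notin> feasible F C p \<and> phi F C p x < \<infinity>}. strong_slope (phi F C p) x)"

end

theory Submission
  imports Defs
begin

text \<open>
  By lower semicontinuity of \<open>F pbar\<close>, the function \<open>phi F C pbar\<close> is lower semicontinuous, so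
  Ekeland's variational principle joins every point \<open>x\<close> where it is finite to a point \<open>z\<close> with
  \<open>t * dist x z \<le> phi F C pbar x\<close> and slope at most \<open>t\<close>; for \<open>t < \<tau>\<close> such a \<open>z\<close> is feasible.
  A point \<open>x\<close> feasible for \<open>p\<close> has \<open>phi F C pbar x \<le> l * dist p pbar\<close>, hence lies within
  \<open>l / t * dist p pbar\<close> of a point feasible for \<open>pbar\<close>, and the Lipschitz bound on \<open>\<theta>\<close> compares the
  two objective values.  Finally the constants tend to their infima.
\<close>

section \<open>Ekeland's variational principle\<close>

text \<open>For finite \<open>f x\<close>, a point \<open>y\<close> violates the inequality iff some
  real \<open>c\<close> fits strictly between \<open>f x - t * dist x y\<close> and
  \<open>f y\<close>, so the complement is a union of open sets. Infinite values of
  \<open>f x\<close> are treated apart.\<close>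

lemma closed_ekeland_set:
  fixes f :: "'x::metric_space \<Rightarrow> ereal"
  assumes lsc: "\<And>a. open {x. a < f x}"
  shows "closed {y. f y + ereal (t * dist x y) \<le> f x}"
proof (cases "f x")
  case (real r)
  have "- {y. f y + ereal (t * dist x y) \<le> f x} =
        (\<Union>c::real. {y. ereal c < f y} \<inter> {y. r - t * dist x y < c})" (is "?A = ?B")
  proof (intro set_eqI iffI)
    fix y assume "y \<in> ?A"
    then have "ereal (r - t * dist x y) < f y"
      using real by (cases "f y") auto
    then obtain c where "ereal (r - t * dist x y) < ereal c" "ereal c < f y"
      using ereal_dense2 by blast
    then show "y \<in> ?B" by auto
  next
    fix y assume "y \<in> ?B"
    then obtain c where "ereal c < f y" "r - t * dist x y < c" by auto
    then show "y \<in> ?A" using real by (cases "f y") auto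
  qed
  moreover have "open ?B"
    by (intro open_UN ballI open_Int lsc open_Collect_less continuous_intros)
  ultimately show ?thesis by (simp add: closed_def)
next
  case PInf
  then show ?thesis by simp
next
  case MInf
  have "{y. f y + ereal (t * dist x y) \<le> f x} = - {y. - \<infinity> < f y}"
    using MInf by auto
  then show ?thesis using lsc[of "-\<infinity>"] by (simp only: closed_Compl)
qed

text \<open>The sets \<open>E x\<close> of the proof are the lower sets of Ekeland's order. Repeated
  passage to a near-minimizer gives nested closed sets with radii tending to 0. Completeness yields
  a common point \<open>z\<close>, and \<open>E z = {z}\<close> is the strict inequality.\<close>

theorem ekeland_variational_principle:
  fixes f :: "'x::metric_space \<Rightarrow> ereal"
  assumes compl: "complete (UNIV :: 'x set)"
    and lsc: "\<And>a. open {x. a < f x}"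
    and nonneg: "\<And>x. 0 \<le> f x"
    and fin: "f x0 < \<infinity>"
    and t: "0 < t"
  obtains z where "f z + ereal (t * dist x0 z) \<le> f x0"
    and "\<And>w. w \<noteq> z \<Longrightarrow> f z < f w + ereal (t * dist z w)"
proof -
  define E where "E x = {y. f y + ereal (t * dist x y) \<le> f x}" for x
  have refl: "x \<in> E x" for x
    by (simp add: E_def)
  have le: "f y \<le> f x" if "y \<in> E x" for x y
    using that t nonneg[of y] nonneg[of x] unfolding E_def
    by (cases "f x"; cases "f y") (auto, smt (verit) mult_nonneg_nonneg zero_le_dist)
  have trans: "E y \<subseteq> E x" if y: "y \<in> E x" for x y
  proof
    fix z assume z: "z \<in> E y"
    have "t * dist x z \<le> t * dist x y + t * dist y z"
      using t by (metis distrib_left dist_triangle less_imp_le mult_left_mono)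
    then show "z \<in> E x"
      using y z unfolding E_def
      by (cases "f x"; cases "f y"; cases "f z") auto
  qed
  \<comment> \<open>Dependent choice: each point minimizes \<open>f\<close> over the preceding set
    up to \<open>(1/2)^n\<close>. The invariant \<open>u n \<in> E x0\<close> keeps the values
    finite.\<close>
  have "\<exists>u. (u 0 \<in> E x0 \<and> (\<forall>n. u n \<in> E x0)) \<and>
      (\<forall>n. u (Suc n) \<in> E (u n) \<and> (\<forall>w\<in>E (u n). f (u (Suc n)) \<le> f w + ereal ((1/2)^n)))"
  proof -
    have step: "\<exists>y. y \<in> E x0 \<and> (y \<in> E x \<and> (\<forall>w\<in>E x. f y \<le> f w + ereal ((1/2)^n)))"
      if x: "x \<in> E x0" for x and n :: nat
    proof -
      define m where "m = (INF w\<in>E x. f w)"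
      have "0 \<le> m" unfolding m_def by (intro INF_greatest nonneg)
      moreover have "m < \<infinity>"
        unfolding m_def using INF_lower[OF refl, of f x] le[OF x] fin by (auto simp: less_le)
      \<comment> \<open>Finiteness of \<open>m\<close> makes the increase strict, so a
        near-minimizer exists.\<close>
      ultimately have "m < m + ereal ((1/2)^n)"
        by (cases m) auto
      then obtain y where y: "y \<in> E x" "f y < m + ereal ((1/2)^n)"
        unfolding m_def using INF_less_iff[of f "E x"] by auto
      have "f y \<le> f w + ereal ((1/2)^n)" if "w \<in> E x" for w
      proof -
        have "m \<le> f w" unfolding m_def using that by (rule INF_lower)
        then show ?thesis using y(2) by (meson add_right_mono less_imp_le order_trans)
      qed
      then show ?thesis using y trans[OF x] by blast
    qed
    show ?thesis
      using dependent_nat_choice[of "\<lambda>_ x. x \<in> E x0"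
          "\<lambda>n x y. y \<in> E x \<and> (\<forall>w\<in>E x. f y \<le> f w + ereal ((1/2)^n))"] step refl
      by metis
  qed
  then obtain u where u0: "\<And>n. u n \<in> E x0" and uS: "\<And>n. u (Suc n) \<in> E (u n)"
    and umin: "\<And>n w. w \<in> E (u n) \<Longrightarrow> f (u (Suc n)) \<le> f w + ereal ((1/2)^n)"
    by blast
  \<comment> \<open>By transitivity \<open>w\<close> also competes in \<open>E (u n)\<close>.
    Near-minimality of \<open>u (Suc n)\<close> there and membership of \<open>w\<close> in
    \<open>E (u (Suc n))\<close> combine, and the finite value \<open>f w\<close> cancels.\<close>
  have small: "t * dist (u (Suc n)) w \<le> (1/2)^n" if w: "w \<in> E (u (Suc n))" for n w
  proof -
    have "w \<in> E (u n)" using w trans[OF uS] by blast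
    then have a: "f (u (Suc n)) \<le> f w + ereal ((1/2)^n)" by (rule umin)
    have b: "f w + ereal (t * dist (u (Suc n)) w) \<le> f (u (Suc n))" using w by (simp add: E_def)
    have "f w \<le> f x0" using le[OF u0] le[OF w] by (metis order_trans)
    then have "\<bar>f w\<bar> \<noteq> \<infinity>" using fin nonneg[of w] by auto
    with a b show ?thesis by (cases "f w"; cases "f (u (Suc n))") auto
  qed
  have mono: "E (u m) \<subseteq> E (u n)" if "n \<le> m" for n m
    using that by (induction rule: dec_induct) (use trans[OF uS] in blast)+
  have mem: "u m \<in> E (u n)" if "n \<le> m" for n m
    using mono[OF that] refl by blast
  have arch: "\<exists>n. (1/2)^n < t * e" if "0 < e" for e
    using real_arch_pow_inv[of "t * e" "1/2"] t that by auto
  have "Cauchy u"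
    unfolding Cauchy_altdef2
  proof (intro allI impI)
    fix e :: real assume "0 < e"
    then obtain n where n: "(1/2)^n < t * e" using arch by blast
    have "dist (u m) (u (Suc n)) < e" if "Suc n \<le> m" for m
    proof -
      have "t * dist (u (Suc n)) (u m) < t * e" using small[OF mem[OF that]] n by linarith
      then show ?thesis using t by (simp add: dist_commute)
    qed
    then show "\<exists>N. \<forall>m\<ge>N. dist (u m) (u N) < e" by blast
  qed
  then obtain z where z: "u \<longlonglongrightarrow> z"
    using compl by (meson UNIV_I completeE)
  have zE: "z \<in> E (u n)" for n
  proof (rule closed_sequentially)
    show "closed (E (u n))" unfolding E_def by (rule closed_ekeland_set[OF lsc])
    show "u (k + n) \<in> E (u n)" for k by (rule mem) simp
    show "(\<lambda>k. u (k + n)) \<longlonglongrightarrow> z" using z by (rule LIMSEQ_ignore_initial_segment)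
  qed
  \<comment> \<open>Both \<open>w\<close> and \<open>z\<close> lie in every
    \<open>E (u (Suc n))\<close>, hence within \<open>(1/2)^n / t\<close> of its centre.\<close>
  have uniq: "w = z" if w: "w \<in> E z" for w
  proof (rule ccontr)
    assume "w \<noteq> z"
    then have "0 < dist w z / 2" by simp
    then obtain n where n: "(1/2)^n < t * (dist w z / 2)" using arch by blast
    have "t * dist (u (Suc n)) w \<le> (1/2)^n" "t * dist (u (Suc n)) z \<le> (1/2)^n"
      using small zE w trans[OF zE] by blast+
    with n have "t * (dist (u (Suc n)) w + dist (u (Suc n)) z) < t * dist w z"
      by (simp add: distrib_left)
    then show False
      using t dist_triangle3[of w z "u (Suc n)"] by simp
  qed
  show thesis
  proof
    show "f z + ereal (t * dist x0 z) \<le> f x0"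
      using zE trans[OF u0] by (auto simp: E_def)
    show "f z < f w + ereal (t * dist z w)" if "w \<noteq> z" for w
    proof (rule ccontr)
      assume "\<not> ?thesis"
      then have "w \<in> E z" by (simp add: E_def not_less)
      with uniq that show False by blast
    qed
  qed
qed

section \<open>From slopes to an error bound for the feasible set\<close>

text \<open>The Ekeland inequality bounds every difference quotient by \<open>t\<close>;
  \<open>0 \<le> t\<close> covers the value 0 at local minimizers.\<close>

lemma strong_slope_le:
  fixes f :: "'x::metric_space \<Rightarrow> ereal"
  assumes "0 \<le> t" and fin: "\<bar>f z\<bar> \<noteq> \<infinity>"
    and lt: "\<And>w. w \<noteq> z \<Longrightarrow> f z \<le> f w + ereal (t * dist z w)"
  shows "strong_slope f z \<le> ereal t"
proof -
  have "(f z - f w) / ereal (dist w z) \<le> ereal t" if "w \<noteq> z" for w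
  proof -
    have "f z - f w \<le> ereal (dist w z) * ereal t"
      using lt[OF that] fin by (cases "f z"; cases "f w") (auto simp: dist_commute mult.commute)
    then show ?thesis
      using that by (simp add: ereal_divide_le_pos)
  qed
  then have "Limsup (at z) (\<lambda>w. (f z - f w) / ereal (dist w z)) \<le> ereal t"
    by (intro Limsup_bounded) (auto simp: eventually_at_filter)
  then show ?thesis
    using \<open>0 \<le> t\<close> by (simp add: strong_slope_def)
qed

text \<open>The supremum exceeds \<open>a\<close> iff \<open>F p x\<close> meets the open set of
  points at distance more than \<open>a\<close> from \<open>C\<close>, and lower semicontinuity
  preserves meeting an open set.\<close>

lemma open_phi_greater:
  assumes "\<And>x. lsc_at (F p) x"
  shows "open {x. a < phi F C p x}"
proof (subst open_subopen, intro ballI)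
  fix x assume "x \<in> {x. a < phi F C p x}"
  then obtain y where y: "y \<in> F p x" "a < ereal (infdist y C)"
    by (auto simp: phi_def less_SUP_iff)
  define U where "U = {y. a < ereal (infdist y C)}"
  have "open U" unfolding U_def
    by (intro open_Collect_less continuous_intros)
  moreover have "F p x \<inter> U \<noteq> {}" using y by (auto simp: U_def)
  ultimately have "\<forall>\<^sub>F z in nhds x. F p z \<inter> U \<noteq> {}"
    using assms by (auto simp: lsc_at_def)
  then obtain S where "open S" "x \<in> S" "\<And>z. z \<in> S \<Longrightarrow> F p z \<inter> U \<noteq> {}"
    unfolding eventually_nhds by blast
  moreover from this have "S \<subseteq> {x. a < phi F C p x}"
    by (fastforce simp: phi_def less_SUP_iff U_def)
  ultimately show "\<exists>T. open T \<and> x \<in> T \<and> T \<subseteq> {x. a < phi F C p x}" by blast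
qed

lemma phi_nonneg:
  assumes "F p x \<noteq> {}"
  shows "0 \<le> phi F C p x"
proof -
  obtain y where "y \<in> F p x" using assms by blast
  then have "ereal (infdist y C) \<le> phi F C p x" unfolding phi_def by (rule SUP_upper)
  then show ?thesis using infdist_nonneg[of y C] by (metis ereal_less_eq(5) order_trans)
qed

text \<open>An infeasible Ekeland point would have slope at most \<open>t\<close>, below the infimum
  \<open>tau F C p\<close> over such points.\<close>

lemma feasible_error_bound:
  fixes F :: "'p \<Rightarrow> 'x::metric_space \<Rightarrow> 'y::metric_space set"
  assumes compl: "complete (UNIV :: 'x set)"
    and ne: "\<And>x. F p x \<noteq> {}"
    and lsc: "\<And>x. lsc_at (F p) x"
    and t: "0 < t" "ereal t < tau F C p"
    and x: "phi F C p x \<le> ereal r"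
  obtains z where "z \<in> feasible F C p" "t * dist x z \<le> r"
proof -
  have fin: "phi F C p x < \<infinity>" using x by auto
  obtain z where z: "phi F C p z + ereal (t * dist x z) \<le> phi F C p x"
    and min: "\<And>w. w \<noteq> z \<Longrightarrow> phi F C p z < phi F C p w + ereal (t * dist z w)"
    using ekeland_variational_principle[of "phi F C p", OF compl open_phi_greater phi_nonneg fin t(1)]
      lsc ne by blast
  \<comment> \<open>Nonnegativity lets the term \<open>phi F C p z\<close> be dropped from the
    Ekeland inequality, leaving the distance estimate.\<close>
  have "0 \<le> phi F C p z" using ne by (rule phi_nonneg)
  with z x have zfin: "\<bar>phi F C p z\<bar> \<noteq> \<infinity>" and d: "t * dist x z \<le> r"
    by (cases "phi F C p z"; cases "phi F C p x"; simp)+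
  have "strong_slope (phi F C p) z \<le> ereal t"
    using t zfin min by (intro strong_slope_le) (auto intro: less_imp_le)
  moreover have "tau F C p \<le> strong_slope (phi F C p) z" if "z \<notin> feasible F C p"
    unfolding tau_def using that zfin by (intro INF_lower) auto
  ultimately have "z \<in> feasible F C p"
    using t(2) by (meson leD order_trans)
  with d that show thesis by blast
qed

section \<open>Perturbation of the parameter\<close>

text \<open>Since \<open>F q x\<close> lies in \<open>C\<close>, the distance to \<open>C\<close> is
  at most the distance to \<open>F q x\<close>, which the excess controls.\<close>

lemma phi_le_of_feasible:
  assumes ne: "F q x \<noteq> {}"
    and x: "x \<in> feasible F C q"
    and h: "(SUP x. haus (F p x) (F q x)) \<le> ereal r"
  shows "phi F C p x \<le> ereal r"
  unfolding phi_def
proof (rule SUP_least)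
  fix y assume y: "y \<in> F p x"
  have "infdist y C \<le> infdist y (F q x)"
    using x ne by (intro infdist_mono) (auto simp: feasible_def)
  moreover have "ereal (infdist y (F q x)) \<le> exc (F p x) (F q x)"
    unfolding exc_def using y by (rule SUP_upper)
  moreover have "exc (F p x) (F q x) \<le> haus (F p x) (F q x)"
    by (simp add: haus_def)
  moreover have "haus (F p x) (F q x) \<le> ereal r"
    using h by (meson SUP_upper UNIV_I order_trans)
  ultimately show "ereal (infdist y C) \<le> ereal r"
    by (meson ereal_less_eq(3) order_trans)
qed

lemma opt_val_eq_of_Argmin:
  assumes "x \<in> Argmin F C \<theta> p"
  shows "opt_val F C \<theta> p = ereal (\<theta> p x)"
  using assms unfolding Argmin_def opt_val_def
  by (intro antisym) (auto intro: INF_lower)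

text \<open>The factor \<open>max 1 (l / t)\<close> bounds the max distance from
  \<open>(q, x)\<close> to \<open>(p, z)\<close> relative to \<open>dist p q\<close>: the entry 1
  comes from the parameters, \<open>l / t\<close> from the error bound.\<close>

lemma calm_below_const_opt_val:
  fixes F :: "'p::metric_space \<Rightarrow> 'x::metric_space \<Rightarrow> 'y::metric_space set"
  assumes ne: "\<And>q x. F q x \<noteq> {}"
    and xbar: "xbar \<in> Argmin F C \<theta> p"
    and compl: "complete (UNIV :: 'x set)"
    and lsc: "\<And>x. lsc_at (F p) x"
    and l: "unif_loc_lipschitz_const F p l"
    and t: "0 < t" "ereal t < tau F C p"
    and L: "0 \<le> L" "max_lipschitz_const \<theta> L"
  shows "calm_below_const (opt_val F C \<theta>) p (L * max 1 (l / t))"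
proof -
  obtain \<delta> where "0 < \<delta>" and \<delta>: "\<And>p1 p2. p1 \<in> cball p \<delta> \<Longrightarrow> p2 \<in> cball p \<delta> \<Longrightarrow>
      (SUP x. haus (F p1 x) (F p2 x)) \<le> ereal (l * dist p1 p2)"
    using l unfolding unif_loc_lipschitz_const_def by blast
  define K where "K = L * max 1 (l / t)"
  have v: "opt_val F C \<theta> p = ereal (\<theta> p xbar)"
    using xbar by (rule opt_val_eq_of_Argmin)
  have "ereal (- K * dist q p) \<le> opt_val F C \<theta> q - opt_val F C \<theta> p" if q: "q \<in> cball p \<delta>" for q
  proof -
    have "ereal (\<theta> p xbar - K * dist q p) \<le> ereal (\<theta> q x)" if x: "x \<in> feasible F C q" for x
    proof -
      have "phi F C p x \<le> ereal (l * dist p q)"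
        using \<open>0 < \<delta>\<close> q by (intro phi_le_of_feasible[OF ne x] \<delta>) auto
      then obtain z where z: "z \<in> feasible F C p" and d: "t * dist x z \<le> l * dist p q"
        using feasible_error_bound[OF compl ne lsc t] by blast
      have "dist x z \<le> l / t * dist p q"
        using d t(1) by (simp add: field_simps)
      also have "\<dots> \<le> max 1 (l / t) * dist p q"
        by (intro mult_right_mono) auto
      finally have "dist z x \<le> max 1 (l / t) * dist p q"
        by (simp add: dist_commute)
      moreover have "dist p q \<le> max 1 (l / t) * dist p q"
        using mult_right_mono[of 1 "max 1 (l / t)" "dist p q"] by simp
      ultimately have "L * max (dist p q) (dist z x) \<le> L * (max 1 (l / t) * dist p q)"
        using L(1) by (intro mult_left_mono) auto
      moreover have "\<bar>\<theta> p z - \<theta> q x\<bar> \<le> L * max (dist p q) (dist z x)"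
        using L(2) by (simp add: max_lipschitz_const_def)
      moreover have "\<theta> p xbar \<le> \<theta> p z"
        using INF_lower[OF z, of "\<lambda>x. ereal (\<theta> p x)"] v by (simp add: opt_val_def)
      ultimately show ?thesis
        by (simp add: K_def dist_commute mult.assoc)
    qed
    \<comment> \<open>This includes parameters \<open>q\<close> with no feasible point, where the
      infimum is \<open>\<infinity>\<close>.\<close>
    then have "ereal (\<theta> p xbar - K * dist q p) \<le> opt_val F C \<theta> q"
      unfolding opt_val_def by (rule INF_greatest)
    then show ?thesis
      unfolding v by (cases "opt_val F C \<theta> q") auto
  qed
  then show ?thesis
    using \<open>0 < \<delta>\<close> unfolding calm_below_const_def K_def by blast
qed

section \<open>Passage to the optimal constants\<close>

text \<open>Serves both \<open>Lip\<close> and \<open>Lip_p\<close>. The infimum may be 0 or not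
  attained, so admissible constants are provided only within \<open>e\<close> of it.\<close>

lemma Inf_pos_const_eq_ereal:
  assumes "0 < l" "Q l"
  shows "\<exists>r\<ge>0. Inf (ereal ` {l. 0 < l \<and> Q l}) = ereal r \<and>
    (\<forall>e>0. \<exists>l>0. Q l \<and> l < r + e)"
proof -
  define I where "I = Inf (ereal ` {l. 0 < l \<and> Q l})"
  have "0 \<le> I" unfolding I_def by (rule INF_greatest) auto
  moreover have "I \<le> ereal l" unfolding I_def using assms by (intro INF_lower) auto
  ultimately obtain r where r: "I = ereal r" "0 \<le> r" by (cases I) auto
  have "\<exists>l>0. Q l \<and> l < r + e" if "0 < e" for e
  proof -
    have "I < ereal (r + e)" using that r by simp
    then show ?thesis unfolding I_def Inf_less_iff by auto
  qed
  with r show ?thesis unfolding I_def by blast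
qed

theorem proposition4p2:
  fixes F :: "'p::metric_space \<Rightarrow> 'x::metric_space \<Rightarrow> 'y::metric_space set"
    and C :: "'y set"
    and \<theta> :: "'p \<Rightarrow> 'x \<Rightarrow> real"
    and pbar :: 'p and xbar :: 'x
  assumes "closed C" and "C \<noteq> {}" and "C \<noteq> UNIV"
    and "\<And>p x. F p x \<noteq> {}"
    and "xbar \<in> Argmin F C \<theta> pbar"
    and "complete (UNIV :: 'x set)"
    and "\<And>x. lsc_at (F pbar) x"
    and "unif_loc_lipschitz F pbar"
    and "tau F C pbar > 0"
    and "max_lipschitz \<theta>"
  shows "calm_from_below (opt_val F C \<theta>) pbar \<and>
         clm_below (opt_val F C \<theta>) pbar \<le> Lip \<theta> * max 1 (Lip_p F pbar / tau F C pbar)"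
proof -
  have calm: "calm_below_const (opt_val F C \<theta>) pbar (L * max 1 (l / t))"
    if "0 < L" "max_lipschitz_const \<theta> L" "unif_loc_lipschitz_const F pbar l"
      "0 < t" "ereal t < tau F C pbar" for L l t
    using assms that by (intro calm_below_const_opt_val[where xbar = xbar]) auto
  obtain l1 where l1: "0 < l1" "unif_loc_lipschitz_const F pbar l1"
    using \<open>unif_loc_lipschitz F pbar\<close> by (auto simp: unif_loc_lipschitz_def)
  obtain l0 where l0: "Lip_p F pbar = ereal l0" "0 \<le> l0"
    "\<And>e. 0 < e \<Longrightarrow> \<exists>l>0. unif_loc_lipschitz_const F pbar l \<and> l < l0 + e"
    using Inf_pos_const_eq_ereal[where Q = "unif_loc_lipschitz_const F pbar",
        OF l1, folded Lip_p_def] by blast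
  obtain L1 where L1: "0 < L1" "max_lipschitz_const \<theta> L1"
    using \<open>max_lipschitz \<theta>\<close> by (auto simp: max_lipschitz_def)
  obtain L0 where L0: "Lip \<theta> = ereal L0" "0 \<le> L0"
    "\<And>e. 0 < e \<Longrightarrow> \<exists>L>0. max_lipschitz_const \<theta> L \<and> L < L0 + e"
    using Inf_pos_const_eq_ereal[where Q = "max_lipschitz_const \<theta>", OF L1, folded Lip_def]
    by blast
  \<comment> \<open>Working with \<open>s = 1 / \<tau>\<close> avoids a separate treatment of \<open>\<tau> = \<infinity>\<close>.\<close>
  obtain s where s: "0 \<le> s" "Lip_p F pbar / tau F C pbar = ereal (l0 * s)"
    "\<And>e. 0 < e \<Longrightarrow> ereal (1 / (s + e)) < tau F C pbar"
  proof (cases "tau F C pbar")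
    case (real r)
    then have "0 < r" using \<open>tau F C pbar > 0\<close> by simp
    have "1 / (1 / r + e) < r" if "0 < e" for e
      using \<open>0 < r\<close> that by (simp add: field_simps add_pos_pos)
    then show thesis
      using real l0 \<open>0 < r\<close> by (intro that[of "1 / r"]) auto
  next
    case PInf
    then show thesis using l0 by (intro that[of 0]) auto
  qed (use \<open>tau F C pbar > 0\<close> in auto)
  \<comment> \<open>The calmness constant with \<open>L\<close>, \<open>l\<close> and
    \<open>1 / t\<close> replaced by \<open>L0 + e\<close>, \<open>l0 + e\<close> and
    \<open>s + e\<close>; \<open>b 0\<close> is the claimed bound.\<close>
  define b where "b e = (L0 + e) * max 1 ((l0 + e) * (s + e))" for e
  have bound: "\<exists>K>0. calm_below_const (opt_val F C \<theta>) pbar K \<and> K \<le> b e" if e: "0 < e" for e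
  proof -
    obtain l where l: "0 < l" "unif_loc_lipschitz_const F pbar l" "l < l0 + e"
      using l0(3) e by blast
    obtain L where L: "0 < L" "max_lipschitz_const \<theta> L" "L < L0 + e"
      using L0(3) e by blast
    have "calm_below_const (opt_val F C \<theta>) pbar (L * max 1 (l / (1 / (s + e))))"
      using l L s e by (intro calm) auto
    moreover have "L * max 1 (l / (1 / (s + e))) \<le> b e"
      unfolding b_def using l L s(1) e
      by (intro mult_mono max.mono) (auto intro: mult_right_mono)
    moreover have "0 < L * max 1 (l / (1 / (s + e)))"
      using L by (simp add: less_max_iff_disj)
    ultimately show ?thesis by blast
  qed
  \<comment> \<open>One value of \<open>e\<close> suffices here; the optimal value is finite because
    it is attained at \<open>xbar\<close>.\<close>
  have "calm_from_below (opt_val F C \<theta>) pbar"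
    using bound[of 1] opt_val_eq_of_Argmin[OF \<open>xbar \<in> Argmin F C \<theta> pbar\<close>]
    by (auto simp: calm_from_below_def)
  \<comment> \<open>\<open>b\<close> is continuous, so the bounds \<open>b e\<close> pass to the
    limit as \<open>e\<close> decreases to 0.\<close>
  moreover have "clm_below (opt_val F C \<theta>) pbar \<le> ereal (b 0)"
  proof (rule tendsto_lowerbound)
    have "(b \<longlongrightarrow> b 0) (at_right 0)"
      unfolding b_def by (intro tendsto_intros)
    then show "((\<lambda>e. ereal (b e)) \<longlongrightarrow> ereal (b 0)) (at_right 0)" by simp
    show "\<forall>\<^sub>F e in at_right 0. clm_below (opt_val F C \<theta>) pbar \<le> ereal (b e)"
      using eventually_at_right_less
    proof eventually_elim
      case (elim e)
      then obtain K where "0 < K" "calm_below_const (opt_val F C \<theta>) pbar K" "K \<le> b e"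
        using bound by blast
      moreover from this have "clm_below (opt_val F C \<theta>) pbar \<le> ereal K"
        unfolding clm_below_def by (intro INF_lower) auto
      ultimately show ?case by (metis ereal_less_eq(3) order_trans)
    qed
  qed simp
  moreover have "ereal (b 0) = Lip \<theta> * max 1 (Lip_p F pbar / tau F C pbar)"
    unfolding s(2) L0(1) b_def by (simp add: max_def)
  ultimately show ?thesis by simp
qed

end
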